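(* Let $c_e>0$, $c_i>0$, $\varepsilon>0$, $\Delta t>0$, $\Delta x>0$. With periodic boundary conditions, the two-step second-order scheme defined in the context is $L^2$-stable under the condition $$\Delta t\le\frac{\Delta x}{c_e},$$ that is, under this condition, $\|w^{n+1}\|_2\le\|w^n\|_2$ for all $n\ge0$.
   Context: The scheme approximates the linear advection equation $\partial_t w+c_e\partial_x w+\frac{c_i}{\sqrt\varepsilon}\partial_x w=0$ with time step $\Delta t$ and space step $\Delta x$. Real unknowns $w^n_j$ (and intermediate values $w_j^\star$, which depend on $n$) are indexed by $j=1,\dots,L$, with periodic boundary conditions $w_0=w_L$, $w_{L+1}=w_1$ for $w=w^n$ and $w=w^\star$, for all $n\ge0$. Put $\beta=1-\frac{\sqrt2}{2}$. Two-step second-order (ARS(2,2,2)) scheme: for $j=1,\dots,L$ and $n\ge 0$, $$w_j^\star=w_j^n-\beta c_e\frac{\Delta t}{\Delta x}(w_j^n-w_{j-1}^n)-\beta\frac{c_i}{\sqrt\varepsilon}\frac{\Delta t}{\Delta x}(w_j^\star-w_{j-1}^\star),$$ $$\begin{aligned}w_j^{n+1}=w_j^n&-(\beta-1)c_e\frac{\Delta t}{\Delta x}(w_j^n-w_{j-1}^n)-(1-\beta)\frac{c_i}{\sqrt\varepsilon}\frac{\Delta t}{\Delta x}(w_j^\star-w_{j-1}^\star)\\&-(2-\beta)c_e\frac{\Delta t}{\Delta x}(w_j^\star-w_{j-1}^\star)-\beta\frac{c_i}{\sqrt\varepsilon}\frac{\Delta t}{\Delta x}(w_j^{n+1}-w_{j-1}^{n+1}).\end{aligned}$$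 Notation: $\|w\|_2=\left(\sum_{j=1}^L|w_j|^2\right)^{1/2}$. *)

theory Defs
  imports "HOL-Analysis.Analysis"
begin

definition ars_beta :: real where
  "ars_beta = 1 - sqrt 2 / 2"

text \<open>
  A grid function with the \<open>L\<close> unknowns \<open>u 1, \<dots>, u L\<close> is a function on \<open>nat\<close>; only
  the values at \<open>0, \<dots>, L + 1\<close> matter, where \<open>0\<close> and \<open>L + 1\<close> are ghost cells.
\<close>

definition periodic_bc :: "nat \<Rightarrow> (nat \<Rightarrow> real) \<Rightarrow> bool" where
  "periodic_bc L u \<longleftrightarrow> u 0 = u L \<and> u (L + 1) = u 1"

text \<open>
  The two stages of one time step, from \<open>u\<close> through the intermediate values \<open>us\<close> to \<open>v\<close>.
  Both stages are implicit, hence relations and not functions of the previous values.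
\<close>

definition ars222_stage1 ::
  "nat \<Rightarrow> real \<Rightarrow> real \<Rightarrow> real \<Rightarrow> real \<Rightarrow> real \<Rightarrow> (nat \<Rightarrow> real) \<Rightarrow> (nat \<Rightarrow> real) \<Rightarrow> bool" where
  "ars222_stage1 L ce ci eps dt dx u us \<longleftrightarrow>
    (\<forall>j\<in>{1..L}.
      us j = u j
        - ars_beta * ce * (dt / dx) * (u j - u (j - 1))
        - ars_beta * (ci / sqrt eps) * (dt / dx) * (us j - us (j - 1)))"

definition ars222_stage2 ::
  "nat \<Rightarrow> real \<Rightarrow> real \<Rightarrow> real \<Rightarrow> real \<Rightarrow> real \<Rightarrow> (nat \<Rightarrow> real) \<Rightarrow> (nat \<Rightarrow> real) \<Rightarrow> (nat \<Rightarrow> real) \<Rightarrow> bool" where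
  "ars222_stage2 L ce ci eps dt dx u us v \<longleftrightarrow>
    (\<forall>j\<in>{1..L}.
      v j = u j
        - (ars_beta - 1) * ce * (dt / dx) * (u j - u (j - 1))
        - (1 - ars_beta) * (ci / sqrt eps) * (dt / dx) * (us j - us (j - 1))
        - (2 - ars_beta) * ce * (dt / dx) * (us j - us (j - 1))
        - ars_beta * (ci / sqrt eps) * (dt / dx) * (v j - v (j - 1)))"

end

theory Submission
  imports Defs
begin

text \<open>
  The scheme is linear with constant coefficients on a periodic grid, so everything is decided by
  its symbol in \<open>z = 1 - exp (- \<i> \<theta>)\<close>, the symbol of the backward difference. Write
  \<open>\<sigma> = ce * dt / dx\<close> and \<open>\<mu> = (ci / sqrt eps) * dt / dx\<close> (\<open>s\<close> and \<open>m\<close> in formulas), and \<open>a = \<beta> * \<mu>\<close>. Each stage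
  solves one system with symbol \<open>1 + a z\<close>, hence the amplification factor of a full step is
  \<open>N z / (1 + a z)\<^sup>2\<close> with a quadratic \<open>N z = 1 + b z + c z\<^sup>2\<close>.
  On the circle described by \<open>z\<close> one has \<open>\<bar>z\<bar>\<^sup>2 = 2 r\<close> with \<open>r = Re z\<close> in \<open>[0, 2]\<close>,
  and \<open>\<bar>1 + a z\<bar>\<^sup>4 - \<bar>N z\<bar>\<^sup>2\<close> is a polynomial \<open>r (A + B r)\<close> in \<open>r\<close>. It is
  nonnegative on \<open>[0, 2]\<close> as soon as it is so to first order at \<open>r = 0\<close> and at the highest
  frequency \<open>z = 2\<close>. The first condition holds because \<open>\<beta>\<^sup>2 = 2 \<beta> - 1 / 2\<close>, which
  expresses that the method has order two in time, reduces \<open>A\<close> to the numerical diffusion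
  \<open>2 (\<sigma> + \<mu>)\<close> of the upwind differences. The second one
  is where \<open>\<sigma> \<le> 1\<close> enters.

  The proof runs in physical space, without a Fourier transform. The periodic grid function
  \<open>u\<close> is written as \<open>(1 + a z)\<^sup>2 y\<close>, where \<open>z\<close> now is the backward difference
  (\<open>implicit_step_surj\<close>). Injectivity of \<open>1 + a z\<close> gives \<open>N z y\<close> for the result of the
  step (\<open>implicit_step_inj\<close>). The
  nonnegativity on \<open>[0, 2]\<close> becomes the identity \<open>energy_identity\<close>, whose right-hand side
  is a combination of squares: multiplication by \<open>r (2 - r)\<close> corresponds to the energy of
  \<open>z (2 - z) y\<close> and multiplication by \<open>r\<^sup>2\<close> to that of \<open>z\<^sup>2 y\<close>, both up to the factor \<open>1/4\<close>.
\<close>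

section \<open>Periodic functions on the integers\<close>

definition periodic :: "nat \<Rightarrow> (int \<Rightarrow> real) \<Rightarrow> bool" where
  "periodic L f \<longleftrightarrow> (\<forall>j. f (j + int L) = f j)"

definition period_sum :: "nat \<Rightarrow> (int \<Rightarrow> real) \<Rightarrow> real" where
  "period_sum L f = (\<Sum>j\<in>{1..int L}. f j)"

lemma periodicD: "periodic L f \<Longrightarrow> f (j + int L) = f j"
  by (simp add: periodic_def)

lemma periodic_minus_period: "periodic L f \<Longrightarrow> f (j - int L) = f j"
  using periodicD[of L f "j - int L"] by simp

lemma periodic_shift: "periodic L f \<Longrightarrow> periodic L (\<lambda>j. f (j - k))"
  unfolding periodic_def by (metis add_diff_eq diff_add_eq)

lemma periodic_mult: "periodic L f \<Longrightarrow> periodic L g \<Longrightarrow> periodic L (\<lambda>j. f j * g j)"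
  by (simp add: periodic_def)

lemma period_sum_shift:
  assumes "periodic L f"
  shows "period_sum L (\<lambda>j. f (j - 1)) = period_sum L f"
proof (cases "L = 0")
  case False
  have "period_sum L (\<lambda>j. f (j - 1)) = (\<Sum>j\<in>{0..int L - 1}. f j)"
    unfolding period_sum_def
    by (rule sum.reindex_bij_witness[of _ "\<lambda>j. j + 1" "\<lambda>j. j - 1"]) auto
  also have "\<dots> = f 0 + (\<Sum>j\<in>{1..int L - 1}. f j)"
  proof -
    have "{0..int L - 1} = insert 0 {1..int L - 1}" using False by auto
    then show ?thesis by simp
  qed
  also have "f 0 = f (int L)" using periodicD[OF assms, of 0] by simp
  also have "f (int L) + (\<Sum>j\<in>{1..int L - 1}. f j) = period_sum L f"
  proof -
    have "{1..int L} = insert (int L) {1..int L - 1}" using False by auto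
    then show ?thesis by (simp add: period_sum_def)
  qed
  finally show ?thesis .
qed (simp add: period_sum_def)

lemma periodic_eq_zero:
  assumes per: "periodic L f" and L: "L \<ge> 1" and zero: "period_sum L (\<lambda>j. (f j)\<^sup>2) = 0"
  shows "f j = 0"
proof -
  have "\<forall>i\<in>{1..int L}. (f i)\<^sup>2 = 0"
    using zero unfolding period_sum_def by (subst sum_nonneg_eq_0_iff[symmetric]) auto
  then have base: "f i = 0" if "i \<in> {1..int L}" for i using that by simp
  have shift: "f (i + int L * int n) = f i" for i n
  proof (induction n)
    case (Suc n)
    have "f (i + int L * int (Suc n)) = f (i + int L * int n + int L)"
      by (simp add: algebra_simps)
    then show ?case using Suc periodicD[OF per] by simp
  qed simp
  define i where "i = (j - 1) mod int L + 1"
  define m where "m = (j - 1) div int L"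
  have i: "i \<in> {1..int L}"
    using L pos_mod_bound[of "int L" "j - 1"] pos_mod_sign[of "int L" "j - 1"]
    unfolding i_def atLeastAtMost_iff by linarith
  have j: "j = i + int L * m" unfolding i_def m_def
    by (metis add.commute add.left_commute diff_add_cancel mult_div_mod_eq)
  show ?thesis
  proof (cases "m \<ge> 0")
    case True
    then show ?thesis using shift[of i "nat m"] base[OF i] j by simp
  next
    case False
    then have "i = j + int L * int (nat (- m))" using j by simp
    then show ?thesis using shift[of j "nat (- m)"] base[OF i] by simp
  qed
qed

section \<open>The implicit operator\<close>

definition implicit_step :: "real \<Rightarrow> (int \<Rightarrow> real) \<Rightarrow> int \<Rightarrow> real" where
  "implicit_step a f j = f j + a * (f j - f (j - 1))"

text \<open>
  A function in the kernel is geometric with ratio \<open>a / (1 + a) < 1\<close>, so that its energy, which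
  is invariant under shifts, is a proper fraction of itself.
\<close>
lemma implicit_step_inj:
  assumes f: "periodic L f" and g: "periodic L g" and L: "L \<ge> 1" and a: "a > 0"
    and eq: "\<And>j. implicit_step a f j = implicit_step a g j"
  shows "f j = g j"
proof -
  define h where "h j = f j - g j" for j
  have h: "periodic L h" using f g by (simp add: h_def periodic_def)
  have "(1 + a) * h j = a * h (j - 1)" for j
    using eq[of j] by (simp add: implicit_step_def h_def algebra_simps)
  then have "((1 + a) * h j)\<^sup>2 = (a * h (j - 1))\<^sup>2" for j by simp
  then have "period_sum L (\<lambda>j. (1 + a)\<^sup>2 * (h j)\<^sup>2) = period_sum L (\<lambda>j. a\<^sup>2 * (h (j - 1))\<^sup>2)"
    by (simp add: power_mult_distrib)
  then have "(1 + a)\<^sup>2 * period_sum L (\<lambda>j. (h j)\<^sup>2) = a\<^sup>2 * period_sum L (\<lambda>j. (h (j - 1))\<^sup>2)"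
    by (simp add: period_sum_def sum_distrib_left)
  also have "period_sum L (\<lambda>j. (h (j - 1))\<^sup>2) = period_sum L (\<lambda>j. (h j)\<^sup>2)"
    using period_sum_shift[OF periodic_mult[OF h h]] by (simp add: power2_eq_square)
  finally have "(1 + 2 * a) * period_sum L (\<lambda>j. (h j)\<^sup>2) = 0"
    by (simp add: power2_eq_square algebra_simps)
  then have "period_sum L (\<lambda>j. (h j)\<^sup>2) = 0" using a by simp
  from periodic_eq_zero[OF h L this, of j] show ?thesis by (simp add: h_def)
qed

text \<open>
  With \<open>q = a / (1 + a)\<close>, the inverse of \<open>(1 + a) (1 - q S)\<close>, where \<open>S\<close> is the shift, is given
  by a geometric series in \<open>S\<close>. As \<open>S\<close> to the power \<open>L\<close> acts as the identity, the series folds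
  to its first \<open>L\<close> terms divided by \<open>1 - q ^ L\<close>.
\<close>
lemma implicit_step_surj:
  assumes u: "periodic L u" and L: "L \<ge> 1" and a: "a > 0"
  obtains y where "periodic L y" and "\<And>j. implicit_step a y j = u j"
proof
  define q where "q = a / (1 + a)"
  have q: "0 < q" "q < 1" and aq: "a = (1 + a) * q" using a by (auto simp: q_def)
  have qL: "q ^ L \<noteq> 1" using q L power_Suc_less_one[of q "L - 1"] by simp
  define S where "S j = (\<Sum>m<L. q ^ m * u (j - int m))" for j
  define y where "y j = S j / ((1 + a) * (1 - q ^ L))" for j
  have "S (j + int L) = S j" for j
    unfolding S_def using periodicD[OF periodic_shift[OF u]] by simp
  then show "periodic L y" by (simp add: periodic_def y_def)
  fix j
  have "S j - q * S (j - 1)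
      = (\<Sum>m<L. q ^ m * u (j - int m) - q ^ Suc m * u (j - int (Suc m)))"
    unfolding S_def by (simp add: sum_subtractf sum_distrib_left algebra_simps)
  also have "\<dots> = u j - q ^ L * u (j - int L)"
    by (subst sum_lessThan_telescope') simp
  also have "\<dots> = (1 - q ^ L) * u j"
    using periodic_minus_period[OF u] by (simp add: algebra_simps)
  finally have S: "S j - q * S (j - 1) = (1 - q ^ L) * u j" .
  have "implicit_step a y j = (1 + a) * (y j - q * y (j - 1))"
    using aq unfolding implicit_step_def by algebra
  also have "\<dots> = (1 + a) * ((S j - q * S (j - 1)) / ((1 + a) * (1 - q ^ L)))"
    by (simp add: y_def diff_divide_distrib)
  also have "\<dots> = u j" unfolding S using qL a by simp
  finally show "implicit_step a y j = u j" .
qed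

section \<open>The energy estimate\<close>

definition autocorr :: "nat \<Rightarrow> (int \<Rightarrow> real) \<Rightarrow> int \<Rightarrow> real" where
  "autocorr L y k = period_sum L (\<lambda>j. y j * y (j - k))"

lemma stencil_energy:
  assumes y: "periodic L y"
  shows "period_sum L (\<lambda>j. (p * y j + q * y (j - 1) + r * y (j - 2))\<^sup>2)
    = (p\<^sup>2 + q\<^sup>2 + r\<^sup>2) * autocorr L y 0 + 2 * (p * q + q * r) * autocorr L y 1
      + 2 * (p * r) * autocorr L y 2"
proof -
  have shift: "period_sum L (\<lambda>j. y (j - 1) * y (j - 1 - k)) = autocorr L y k" for k
    unfolding autocorr_def
    using period_sum_shift[OF periodic_mult[OF y periodic_shift[OF y, of k]]] by simp
  have shift2: "period_sum L (\<lambda>j. y (j - 2) * y (j - 2)) = autocorr L y 0"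
    using period_sum_shift[OF periodic_mult[OF periodic_shift[OF y, of 1] periodic_shift[OF y, of 1]]]
      shift[of 0] by simp
  have "period_sum L (\<lambda>j. (p * y j + q * y (j - 1) + r * y (j - 2))\<^sup>2)
    = p\<^sup>2 * period_sum L (\<lambda>j. y j * y (j - 0)) + q\<^sup>2 * period_sum L (\<lambda>j. y (j - 1) * y (j - 1 - 0))
      + r\<^sup>2 * period_sum L (\<lambda>j. y (j - 2) * y (j - 2))
      + 2 * (p * q) * period_sum L (\<lambda>j. y j * y (j - 1))
      + 2 * (q * r) * period_sum L (\<lambda>j. y (j - 1) * y (j - 1 - 1))
      + 2 * (p * r) * period_sum L (\<lambda>j. y j * y (j - 2))"
    unfolding period_sum_def sum_distrib_left sum.distrib[symmetric]
    by (rule sum.cong) (auto simp: power2_eq_square algebra_simps)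
  also have "\<dots> = (p\<^sup>2 + q\<^sup>2 + r\<^sup>2) * autocorr L y 0 + 2 * (p * q + q * r) * autocorr L y 1
      + 2 * (p * r) * autocorr L y 2"
    unfolding shift shift2 by (simp add: autocorr_def algebra_simps)
  finally show ?thesis .
qed

text \<open>The operator with symbol \<open>1 + b z + c z\<^sup>2\<close>.\<close>
definition quad_diff :: "real \<Rightarrow> real \<Rightarrow> (int \<Rightarrow> real) \<Rightarrow> int \<Rightarrow> real" where
  "quad_diff b c y j = (1 + b + c) * y j - (b + 2 * c) * y (j - 1) + c * y (j - 2)"

text \<open>
  In terms of \<open>r = Re z\<close>, where \<open>\<bar>z\<bar>\<^sup>2 = 2 r\<close> and \<open>Re (z\<^sup>2) = 2 r\<^sup>2 - 2 r\<close>, the difference of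
  the squared symbols is a polynomial \<open>r (A + B r)\<close>. The factor \<open>A + B r\<close> is affine and
  thus equal to \<open>A (2 - r) / 2 + C r / 2\<close> with \<open>C = A + 2 B\<close>, which can be read off at \<open>z = 2\<close>.
  The two differences on the right have the squared symbols \<open>4 r (2 - r)\<close> and \<open>4 r\<^sup>2\<close>.
\<close>
lemma energy_identity:
  fixes a b c :: real
  assumes y: "periodic L y"
  defines "A \<equiv> 4 * a * (1 + a) - 2 * b\<^sup>2 - 2 * b + 4 * c"
    and "C \<equiv> ((1 + 2 * a) ^ 4 - (1 + 2 * b + 4 * c)\<^sup>2) / 2"
  shows "period_sum L (\<lambda>j. (implicit_step a (implicit_step a y) j)\<^sup>2)
      - period_sum L (\<lambda>j. (quad_diff b c y j)\<^sup>2)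
    = A / 8 * period_sum L (\<lambda>j. (y j - y (j - 2))\<^sup>2)
      + C / 8 * period_sum L (\<lambda>j. (y j - 2 * y (j - 1) + y (j - 2))\<^sup>2)"
proof -
  have D: "implicit_step a (implicit_step a y) j
      = (1 + a)\<^sup>2 * y j + (- 2 * a * (1 + a)) * y (j - 1) + a\<^sup>2 * y (j - 2)" for j
    by (simp add: implicit_step_def power2_eq_square algebra_simps)
  have N: "quad_diff b c y j = (1 + b + c) * y j + (- b - 2 * c) * y (j - 1) + c * y (j - 2)" for j
    by (simp add: quad_diff_def algebra_simps)
  have E1: "y j - y (j - 2) = 1 * y j + 0 * y (j - 1) + (- 1) * y (j - 2)" for j by simp
  have E2: "y j - 2 * y (j - 1) + y (j - 2) = 1 * y j + (- 2) * y (j - 1) + 1 * y (j - 2)" for j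
    by simp
  show ?thesis
    unfolding D N E1 E2 stencil_energy[OF y] A_def C_def
    by (simp add: field_simps power2_eq_square power4_eq_xxxx)
qed

lemma energy_estimate:
  fixes a b c :: real
  assumes y: "periodic L y"
    and diffusive: "0 \<le> 4 * a * (1 + a) - 2 * b\<^sup>2 - 2 * b + 4 * c"
    and high_freq: "\<bar>1 + 2 * b + 4 * c\<bar> \<le> (1 + 2 * a)\<^sup>2"
  shows "period_sum L (\<lambda>j. (quad_diff b c y j)\<^sup>2)
    \<le> period_sum L (\<lambda>j. (implicit_step a (implicit_step a y) j)\<^sup>2)"
proof -
  have "(1 + 2 * b + 4 * c)\<^sup>2 \<le> ((1 + 2 * a)\<^sup>2)\<^sup>2"
    using power_mono[OF high_freq, of 2] by simp
  then have C: "0 \<le> ((1 + 2 * a) ^ 4 - (1 + 2 * b + 4 * c)\<^sup>2) / 2"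
    by (simp flip: power_mult)
  have nonneg: "0 \<le> period_sum L (\<lambda>j. (f j)\<^sup>2)" for f
    unfolding period_sum_def by (rule sum_nonneg) simp
  have "0 \<le> period_sum L (\<lambda>j. (implicit_step a (implicit_step a y) j)\<^sup>2)
      - period_sum L (\<lambda>j. (quad_diff b c y j)\<^sup>2)"
    unfolding energy_identity[OF y] using diffusive C nonneg
    by (intro add_nonneg_nonneg mult_nonneg_nonneg) auto
  then show ?thesis by simp
qed

section \<open>The two stages of the scheme\<close>

lemma ars_beta_quadratic: "ars_beta\<^sup>2 = 2 * ars_beta - 1 / 2"
  by (simp add: ars_beta_def power2_eq_square field_simps)

lemma ars_beta_bounds: "1 / 4 \<le> ars_beta" "ars_beta \<le> 1 / 2"
proof -
  have "sqrt 2 \<le> 3 / 2" by (rule real_le_lsqrt) (auto simp: power2_eq_square)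
  then show "1 / 4 \<le> ars_beta" by (simp add: ars_beta_def)
  have "1 \<le> sqrt 2" by simp
  then show "ars_beta \<le> 1 / 2" by (simp add: ars_beta_def)
qed

text \<open>
  The coefficients \<open>b\<close> and \<open>c\<close> of the numerator
  \<open>(1 + (1 - \<beta>) \<sigma> z) (1 + \<beta> \<mu> z) - ((1 - \<beta>) \<mu> + (2 - \<beta>) \<sigma>) z (1 - \<beta> \<sigma> z)\<close>
  of the amplification factor.
\<close>
definition ars_b :: "real \<Rightarrow> real \<Rightarrow> real" where
  "ars_b s m = (1 - ars_beta) * s + ars_beta * m - ((1 - ars_beta) * m + (2 - ars_beta) * s)"

definition ars_c :: "real \<Rightarrow> real \<Rightarrow> real" where
  "ars_c s m = (1 - ars_beta) * s * (ars_beta * m)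
     + ((1 - ars_beta) * m + (2 - ars_beta) * s) * (ars_beta * s)"

lemma ars_b_eq: "ars_b s m = - s - (1 - 2 * ars_beta) * m"
  by (simp add: ars_b_def algebra_simps)

lemma ars_c_eq: "ars_c s m = (1 - 2 * ars_beta) * s * m + s\<^sup>2 / 2"
proof -
  have "ars_c s m = (2 * ars_beta - 2 * ars_beta\<^sup>2) * s * m + (2 * ars_beta - ars_beta\<^sup>2) * s\<^sup>2"
    by (simp add: ars_c_def power2_eq_square algebra_simps)
  then show ?thesis by (simp add: ars_beta_quadratic algebra_simps)
qed

text \<open>
  To first order in \<open>r\<close>, all terms quadratic in \<open>s\<close> and \<open>m\<close> cancel. This
  is second-order accuracy in time, and leaves the diffusion of the upwind differences.
\<close>
lemma ars_diffusive:
  "4 * (ars_beta * m) * (1 + ars_beta * m) - 2 * (ars_b s m)\<^sup>2 - 2 * ars_b s m + 4 * ars_c s m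
    = 2 * (s + m)"
proof -
  have "4 * (ars_beta * m) * (1 + ars_beta * m) - 2 * (ars_b s m)\<^sup>2 - 2 * ars_b s m
      + 4 * ars_c s m = 2 * (s + m) + (8 * ars_beta - 2 - 4 * ars_beta\<^sup>2) * m\<^sup>2"
    by (simp add: ars_b_eq ars_c_eq power2_eq_square algebra_simps)
  then show ?thesis by (simp add: ars_beta_quadratic)
qed

text \<open>
  The bound \<open>s \<le> 1\<close> is needed for the upper estimate: as \<open>m\<close> tends to \<open>0\<close>, the gap
  tends to \<open>2 s (1 - s)\<close>.
\<close>
lemma ars_high_freq:
  assumes s: "0 \<le> s" "s \<le> 1" and m: "0 \<le> m"
  shows "\<bar>1 + 2 * ars_b s m + 4 * ars_c s m\<bar> \<le> (1 + 2 * (ars_beta * m))\<^sup>2"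
proof -
  define \<beta> where "\<beta> = ars_beta"
  have \<beta>: "1 / 4 \<le> \<beta>" "\<beta> \<le> 1 / 2" using ars_beta_bounds by (auto simp: \<beta>_def)
  have "(1 - 2 * \<beta>) * s \<le> 1 / 2 * 1" using \<beta> s by (intro mult_mono) auto
  then have "0 \<le> 2 - 4 * ((1 - 2 * \<beta>) * s)" by linarith
  then have "0 \<le> 2 * s * (1 - s) + m * (2 - 4 * ((1 - 2 * \<beta>) * s)) + 4 * \<beta>\<^sup>2 * m\<^sup>2"
    using s m by (intro add_nonneg_nonneg mult_nonneg_nonneg) auto
  also have "\<dots> = (1 + 2 * (\<beta> * m))\<^sup>2 - (1 + 2 * ars_b s m + 4 * ars_c s m)"
    by (simp add: ars_b_eq ars_c_eq \<beta>_def power2_eq_square algebra_simps)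
  finally have upper: "1 + 2 * ars_b s m + 4 * ars_c s m \<le> (1 + 2 * (\<beta> * m))\<^sup>2" by simp
  have "0 \<le> 2 * (1 - s) + 2 * s\<^sup>2 + m * (8 * \<beta> - 2) + 4 * ((1 - 2 * \<beta>) * s * m) + 4 * \<beta>\<^sup>2 * m\<^sup>2"
    using \<beta> s m by (intro add_nonneg_nonneg mult_nonneg_nonneg) auto
  also have "\<dots> = (1 + 2 * (\<beta> * m))\<^sup>2 + (1 + 2 * ars_b s m + 4 * ars_c s m)"
    by (simp add: ars_b_eq ars_c_eq \<beta>_def power2_eq_square algebra_simps)
  finally show ?thesis using upper by (simp add: \<beta>_def)
qed

text \<open>
  Writing \<open>u = (1 + a z)\<^sup>2 y\<close> makes all divisions by \<open>1 + a z\<close> explicit: the first stage is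
  \<open>(1 - \<beta> \<sigma> z) (1 + a z) y\<close> and the second one \<open>N z y\<close>, because these functions solve the
  implicit equations and the solutions are unique.
\<close>
lemma ars222_periodic_stability:
  fixes u us v :: "int \<Rightarrow> real"
  assumes L: "L \<ge> 1" and s: "0 \<le> s" "s \<le> 1" and m: "0 < m"
    and u: "periodic L u" and us: "periodic L us" and v: "periodic L v"
    and stage1: "\<And>j. us j = u j - ars_beta * s * (u j - u (j - 1))
        - ars_beta * m * (us j - us (j - 1))"
    and stage2: "\<And>j. v j = u j - (ars_beta - 1) * s * (u j - u (j - 1))
        - (1 - ars_beta) * m * (us j - us (j - 1))
        - (2 - ars_beta) * s * (us j - us (j - 1))
        - ars_beta * m * (v j - v (j - 1))"
  shows "period_sum L (\<lambda>j. (v j)\<^sup>2) \<le> period_sum L (\<lambda>j. (u j)\<^sup>2)"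
proof -
  define a where "a = ars_beta * m"
  have a: "a > 0" using m ars_beta_bounds by (simp add: a_def)
  obtain x where x: "periodic L x" and ux: "\<And>j. implicit_step a x j = u j"
    using implicit_step_surj[OF u L a] by blast
  obtain y where y: "periodic L y" and xy: "\<And>j. implicit_step a y j = x j"
    using implicit_step_surj[OF x L a] by blast
  define us' where "us' j = x j - ars_beta * s * (x j - x (j - 1))" for j
  have "periodic L us'"
    using x periodic_shift[OF x, of 1] by (simp add: us'_def periodic_def)
  moreover have "implicit_step a us j = implicit_step a us' j" for j
  proof -
    have "implicit_step a us j = u j - ars_beta * s * (u j - u (j - 1))"
      using stage1[of j] by (simp add: implicit_step_def a_def)
    also have "\<dots> = implicit_step a us' j"
      by (simp add: ux[symmetric] implicit_step_def us'_def algebra_simps)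
    finally show ?thesis .
  qed
  ultimately have us_eq: "us j = us' j" for j
    using implicit_step_inj[OF us _ L a] by blast
  have "periodic L (quad_diff (ars_b s m) (ars_c s m) y)"
    using y periodic_shift[OF y, of 1] periodic_shift[OF y, of 2]
    by (simp add: quad_diff_def periodic_def)
  moreover have "implicit_step a v j
      = implicit_step a (quad_diff (ars_b s m) (ars_c s m) y) j" for j
  proof -
    define d where "d = (1 - ars_beta) * m + (2 - ars_beta) * s"
    have b: "ars_b s m = (1 - ars_beta) * s + a - d"
      and c: "ars_c s m = (1 - ars_beta) * s * a + d * (ars_beta * s)"
      by (simp_all add: ars_b_def ars_c_def a_def d_def)
    have "implicit_step a v j = u j + (1 - ars_beta) * s * (u j - u (j - 1))
        - d * (us j - us (j - 1))"
      using stage2[of j] by (simp add: implicit_step_def a_def d_def algebra_simps)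
    also have "\<dots> = implicit_step a (quad_diff (ars_b s m) (ars_c s m) y) j"
      unfolding us_eq us'_def b c
      by (simp add: ux[symmetric] xy[symmetric] implicit_step_def quad_diff_def algebra_simps)
    finally show ?thesis .
  qed
  ultimately have v_eq: "v j = quad_diff (ars_b s m) (ars_c s m) y j" for j
    using implicit_step_inj[OF v _ L a] by blast
  have "implicit_step a y = x" using xy by (rule ext)
  then have u_eq: "u j = implicit_step a (implicit_step a y) j" for j
    using ux by simp
  show ?thesis unfolding v_eq u_eq
  proof (rule energy_estimate[OF y])
    show "0 \<le> 4 * a * (1 + a) - 2 * (ars_b s m)\<^sup>2 - 2 * ars_b s m + 4 * ars_c s m"
      unfolding a_def ars_diffusive using s m by simp
    show "\<bar>1 + 2 * ars_b s m + 4 * ars_c s m\<bar> \<le> (1 + 2 * a)\<^sup>2"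
      unfolding a_def using ars_high_freq[OF s] m by simp
  qed
qed

section \<open>Periodic extension of grid functions\<close>

definition cell :: "nat \<Rightarrow> int \<Rightarrow> nat" where
  "cell L j = nat ((j - 1) mod int L) + 1"

definition extension :: "nat \<Rightarrow> (nat \<Rightarrow> real) \<Rightarrow> int \<Rightarrow> real" where
  "extension L u j = u (cell L j)"

lemma cell_in: "L \<ge> 1 \<Longrightarrow> cell L j \<in> {1..L}"
  using pos_mod_bound[of "int L" "j - 1"] pos_mod_sign[of "int L" "j - 1"]
  unfolding cell_def atLeastAtMost_iff by linarith

lemma periodic_extension: "periodic L (extension L u)"
proof -
  have "(j + int L - 1) mod int L = (j - 1) mod int L" for j
    by (metis add_diff_eq diff_add_eq mod_add_self2)
  then show ?thesis by (simp add: periodic_def extension_def cell_def)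
qed

text \<open>The ghost cell \<open>0\<close> serves as left neighbour exactly when \<open>j\<close> lies in cell \<open>1\<close>.\<close>
lemma extension_pred:
  assumes L: "L \<ge> 1" and u: "u 0 = u L"
  shows "extension L u (j - 1) = u (cell L j - 1)"
proof -
  define i where "i = (j - 1) mod int L"
  have i: "0 \<le> i" "i < int L" using L by (auto simp: i_def)
  have pred: "(j - 1 - 1) mod int L = (i - 1) mod int L"
    by (simp add: i_def mod_diff_left_eq)
  show ?thesis
  proof (cases "i = 0")
    case True
    have "(i - 1) mod int L = int L - 1"
      using True L by (simp add: zmod_minus1)
    then have "cell L (j - 1) = L" using L pred by (simp add: cell_def nat_diff_distrib)
    moreover have "cell L j = 1" using True by (simp add: cell_def i_def)
    ultimately show ?thesis using u by (simp add: extension_def)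
  next
    case False
    then have "(i - 1) mod int L = i - 1" using i by simp
    then have "cell L (j - 1) = nat (i - 1) + 1" using pred by (simp add: cell_def)
    also have "\<dots> = cell L j - 1" using False i by (simp add: cell_def flip: i_def)
    finally show ?thesis by (simp add: extension_def)
  qed
qed

lemma period_sum_extension:
  "period_sum L (\<lambda>j. (extension L u j)\<^sup>2) = (\<Sum>j\<in>{1..L}. (u j)\<^sup>2)"
  unfolding period_sum_def
  by (rule sum.reindex_bij_witness[of _ int nat])
    (auto simp: extension_def cell_def nat_diff_distrib)

theorem proposition2:
  fixes L :: nat
    and ce ci eps dt dx :: real
    and w ws :: "nat \<Rightarrow> nat \<Rightarrow> real"
  assumes "L \<ge> 1"
    and "ce > 0" and "ci > 0" and "eps > 0" and "dt > 0" and "dx > 0"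
    and "\<And>n. periodic_bc L (w n)"
    and "\<And>n. periodic_bc L (ws n)"
    and "\<And>n. ars222_stage1 L ce ci eps dt dx (w n) (ws n)"
    and "\<And>n. ars222_stage2 L ce ci eps dt dx (w n) (ws n) (w (n + 1))"
    and "dt \<le> dx / ce"
  shows "\<forall>n. L2_set (w (n + 1)) {1..L} \<le> L2_set (w n) {1..L}"
proof
  fix n
  define s where "s = ce * (dt / dx)"
  define m where "m = ci / sqrt eps * (dt / dx)"
  have s: "0 \<le> s" "s \<le> 1" and m: "0 < m"
    using assms(2-6,11) by (auto simp: s_def m_def field_simps)
  have bc: "w k 0 = w k L" "ws k 0 = ws k L" for k
    using assms(7,8) by (auto simp: periodic_bc_def)
  note pred = extension_pred[of L "w k" for k, OF assms(1) bc(1)]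
    extension_pred[of L "ws k" for k, OF assms(1) bc(2)]
  have "period_sum L (\<lambda>j. (extension L (w (n + 1)) j)\<^sup>2)
      \<le> period_sum L (\<lambda>j. (extension L (w n) j)\<^sup>2)"
  proof (rule ars222_periodic_stability[OF assms(1) s m, of _ "extension L (ws n)"])
    fix j
    note i = cell_in[OF assms(1), of j]
    show "extension L (ws n) j = extension L (w n) j
        - ars_beta * s * (extension L (w n) j - extension L (w n) (j - 1))
        - ars_beta * m * (extension L (ws n) j - extension L (ws n) (j - 1))"
      unfolding pred unfolding extension_def
      using assms(9)[of n, unfolded ars222_stage1_def, rule_format, OF i]
      by (simp add: s_def m_def mult.assoc)
    show "extension L (w (n + 1)) j = extension L (w n) j
        - (ars_beta - 1) * s * (extension L (w n) j - extension L (w n) (j - 1))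
        - (1 - ars_beta) * m * (extension L (ws n) j - extension L (ws n) (j - 1))
        - (2 - ars_beta) * s * (extension L (ws n) j - extension L (ws n) (j - 1))
        - ars_beta * m * (extension L (w (n + 1)) j - extension L (w (n + 1)) (j - 1))"
      unfolding pred unfolding extension_def
      using assms(10)[of n, unfolded ars222_stage2_def, rule_format, OF i]
      by (simp only: s_def m_def mult.assoc)
  qed (rule periodic_extension)+
  then show "L2_set (w (n + 1)) {1..L} \<le> L2_set (w n) {1..L}"
    unfolding L2_set_def period_sum_extension by simp
qed

end
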